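(* Let $L$ be any formal language over a finite alphabet and let $d = lev_{\gamma,\theta}$ be a generalized Levenshtein distance with insertion/removal weight $\gamma>0$ and replacement weight $\theta>0$ such that $\theta<2\gamma$. Then the isometry group $Isom_d(L)$ embeds in $\prod_{n=1}^\infty S_n$.
   Context: For a finite alphabet $A$, $A^*$ is the set of all finite words over $A$ (including the empty word), and a formal language is a subset of $A^*$. For real $\gamma,\theta>0$ the generalized Levenshtein distance with insertion (equivalently, removal) weight $\gamma$ and replacement weight $\theta$ is $$lev_{\gamma,\theta}(u,v)=\min\{\gamma n+\theta m \mid u \text{ can be transformed into } v \text{ by } n \text{ insertions or deletions of single characters and } m \text{ replacements of single characters}\}$$ where the intermediate words are arbitrary words of $A^*$. It is a metric on $A^*$. $Isom_d(L)$ is the group (under composition) of all bijections $\phi:L\to L$ with $d(\phi(u),\phi(v))=d(u,v)$ for all $u,v\in L$. $S_n$ is the symmetric group on $n$ elements and $\prod$ denotes the (unrestricted) Cartesian product of groups. "Embeds" means that there is an injective group homomorphism. *)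

theory Defs
  imports Complex_Main "HOL-Algebra.Bij" "HOL-Algebra.Product_Groups" "HOL-Algebra.Sym_Groups"
begin

text \<open>\<open>edits A n m u v\<close>: the word \<open>u\<close> can be transformed into \<open>v\<close> by \<open>n\<close> insertions or deletions
  and \<open>m\<close> replacements of single letters, performed in any order, all words on the way being
  words over \<open>A\<close>.\<close>

inductive edits :: "'a set \<Rightarrow> nat \<Rightarrow> nat \<Rightarrow> 'a list \<Rightarrow> 'a list \<Rightarrow> bool" for A where
  refl: "u \<in> lists A \<Longrightarrow> edits A 0 0 u u"
| ins: "edits A n m u (v @ w) \<Longrightarrow> a \<in> A \<Longrightarrow> edits A (Suc n) m u (v @ a # w)"
| del: "edits A n m u (v @ a # w) \<Longrightarrow> edits A (Suc n) m u (v @ w)"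
| repl: "edits A n m u (v @ a # w) \<Longrightarrow> b \<in> A \<Longrightarrow> edits A n (Suc m) u (v @ b # w)"

text \<open>The minimum exists for positive weights and \<open>u, v \<in> lists A\<close>; see \<open>lev_attained\<close> below.\<close>

definition lev :: "'a set \<Rightarrow> real \<Rightarrow> real \<Rightarrow> 'a list \<Rightarrow> 'a list \<Rightarrow> real" where
  "lev A \<gamma> \<theta> u v = (LEAST x. \<exists>n m. edits A n m u v \<and> x = \<gamma> * real n + \<theta> * real m)"

text \<open>As in \<^const>\<open>Bij\<close>, the elements are extensional functions, so that each bijection of \<open>L\<close>
  is represented by exactly one function.\<close>

definition isom_group :: "('b \<Rightarrow> 'b \<Rightarrow> real) \<Rightarrow> 'b set \<Rightarrow> ('b \<Rightarrow> 'b) monoid" where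
  "isom_group d L = BijGroup L
     \<lparr>carrier := {\<phi> \<in> Bij L. \<forall>u\<in>L. \<forall>v\<in>L. d (\<phi> u) (\<phi> v) = d u v}\<rparr>"

lemma edits_lists:
  assumes "edits A n m u v"
  shows "u \<in> lists A" and "v \<in> lists A"
  using assms by (induction) auto

lemma edits_delete_all: "edits A n m u v \<Longrightarrow> edits A (n + length v) m u []"
proof (induction v arbitrary: n)
  case (Cons a v)
  then have "edits A (Suc n) m u v"
    using edits.del[where v = "[]" and a = a and w = v] by simp
  from Cons.IH[OF this] show ?case by simp
qed simp

lemma edits_insert_all:
  "edits A n m u [] \<Longrightarrow> v \<in> lists A \<Longrightarrow> edits A (n + length v) m u v"
proof (induction v)
  case (Cons a v)
  then have "edits A (n + length v) m u ([] @ v)" "a \<in> A" by auto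
  from edits.ins[OF this] show ?case by simp
qed simp

lemma edits_exists:
  assumes "u \<in> lists A" "v \<in> lists A"
  shows "\<exists>n m. edits A n m u v"
proof -
  have "edits A (0 + length u) 0 u []"
    by (rule edits_delete_all[OF edits.refl[OF assms(1)]])
  from edits_insert_all[OF this assms(2)] show ?thesis by (intro exI)
qed

lemma lev_attained:
  assumes "\<gamma> > 0" "\<theta> > 0" "u \<in> lists A" "v \<in> lists A"
  shows "\<exists>n m. edits A n m u v \<and> lev A \<gamma> \<theta> u v = \<gamma> * real n + \<theta> * real m"
    and "edits A n m u v \<Longrightarrow> lev A \<gamma> \<theta> u v \<le> \<gamma> * real n + \<theta> * real m"
proof -
  define c where "c = (\<lambda>(n, m). \<gamma> * real n + \<theta> * real m)"
  define S where "S = {(n, m). edits A n m u v}"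
  obtain p where p: "p \<in> S"
    using edits_exists[OF assms(3,4)] by (auto simp: S_def)
  define T where "T = {q \<in> S. c q \<le> c p}"
  have "T \<subseteq> {..nat \<lceil>c p / \<gamma>\<rceil>} \<times> {..nat \<lceil>c p / \<theta>\<rceil>}"
  proof
    fix q assume q: "q \<in> T"
    obtain n m where [simp]: "q = (n, m)" by fastforce
    have le: "\<gamma> * real n + \<theta> * real m \<le> c p" using q by (simp add: T_def c_def)
    have "0 \<le> \<gamma> * real n" "0 \<le> \<theta> * real m" using assms by auto
    with le have "\<gamma> * real n \<le> c p" "\<theta> * real m \<le> c p" by linarith+
    then have "real n \<le> c p / \<gamma>" "real m \<le> c p / \<theta>"
      using assms by (simp_all add: field_simps)
    then show "q \<in> {..nat \<lceil>c p / \<gamma>\<rceil>} \<times> {..nat \<lceil>c p / \<theta>\<rceil>}"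
      by simp linarith
  qed
  then have fin: "finite T" by (rule finite_subset) simp
  have "p \<in> T" using p by (simp add: T_def)
  then have ne: "T \<noteq> {}" by blast
  define q where "q = arg_min_on c T"
  have q: "q \<in> T" "\<forall>r\<in>T. c q \<le> c r"
    unfolding q_def using arg_min_if_finite(1)[OF fin ne] arg_min_least[OF fin ne] by blast+
  have min: "c q \<le> c r" if "r \<in> S" for r
  proof (cases "r \<in> T")
    case False
    then have "c p \<le> c r" using that by (auto simp: T_def)
    then show ?thesis using q(1) by (simp add: T_def)
  qed (use q(2) in blast)
  obtain n0 m0 where q0: "q = (n0, m0)" by fastforce
  have ed: "edits A n0 m0 u v" using q(1) by (simp add: T_def S_def q0)
  have le: "\<gamma> * real n0 + \<theta> * real m0 \<le> \<gamma> * real n + \<theta> * real m" if "edits A n m u v" for n m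
  proof -
    have "(n, m) \<in> S" using that by (simp add: S_def)
    from min[OF this] show ?thesis by (simp only: c_def q0 prod.case)
  qed
  have eq: "lev A \<gamma> \<theta> u v = \<gamma> * real n0 + \<theta> * real m0"
    unfolding lev_def
    by (rule Least_equality) (use ed le in blast)+
  show "\<exists>n m. edits A n m u v \<and> lev A \<gamma> \<theta> u v = \<gamma> * real n + \<theta> * real m"
    using ed eq by blast
  show "lev A \<gamma> \<theta> u v \<le> \<gamma> * real n + \<theta> * real m" if "edits A n m u v"
    unfolding eq using that by (rule le)
qed

lemma group_isom_group: "group (isom_group d L)"
proof -
  let ?I = "{\<phi> \<in> Bij L. \<forall>u\<in>L. \<forall>v\<in>L. d (\<phi> u) (\<phi> v) = d u v}"
  interpret B: group "BijGroup L" by (rule group_BijGroup)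
  have inv_eq: "inv\<^bsub>BijGroup L\<^esub> \<phi> = (\<lambda>x\<in>L. inv_into L \<phi> x)" if "\<phi> \<in> Bij L" for \<phi>
    using that by (rule inv_BijGroup)
  have "subgroup ?I (BijGroup L)"
  proof (rule B.subgroupI)
    show "?I \<subseteq> carrier (BijGroup L)" by (auto simp: BijGroup_def)
    have "(\<lambda>x\<in>L. x) \<in> ?I" by (simp add: id_Bij)
    then show "?I \<noteq> {}" by blast
  next
    fix \<phi> assume \<phi>: "\<phi> \<in> ?I"
    then have bij: "bij_betw \<phi> L L" by (simp add: Bij_def)
    have "d (inv_into L \<phi> u) (inv_into L \<phi> v) = d u v" if "u \<in> L" "v \<in> L" for u v
    proof -
      have "inv_into L \<phi> u \<in> L" "inv_into L \<phi> v \<in> L"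
        using bij that by (simp_all add: bij_betw_def inv_into_into)
      with \<phi> have "d (\<phi> (inv_into L \<phi> u)) (\<phi> (inv_into L \<phi> v))
          = d (inv_into L \<phi> u) (inv_into L \<phi> v)" by blast
      then show ?thesis using bij_betw_inv_into_right[OF bij] that by simp
    qed
    then show "inv\<^bsub>BijGroup L\<^esub> \<phi> \<in> ?I"
      using \<phi> by (simp add: inv_eq restrict_inv_into_Bij)
  next
    fix \<phi> \<psi> assume *: "\<phi> \<in> ?I" "\<psi> \<in> ?I"
    then have "\<psi> u \<in> L" if "u \<in> L" for u
      using that Bij_imp_funcset[of \<psi> L] by blast
    with * show "\<phi> \<otimes>\<^bsub>BijGroup L\<^esub> \<psi> \<in> ?I"
      by (simp add: BijGroup_def compose_Bij compose_eq)
  qed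
  then show ?thesis
    unfolding isom_group_def by (rule B.subgroup_imp_group)
qed

end

theory Submission
  imports Defs "HOL-Library.Sublist"
begin

text \<open>All orbits of the isometry group are finite. Suppose that the orbit of \<open>u\<close> is infinite.
  By Higman's lemma it contains two long words \<open>a = \<phi> u\<close> and \<open>b\<close>, of very different lengths, such
  that \<open>a\<close> is a scattered subword of \<open>b\<close>; so \<open>u\<close>, \<open>a\<close>, \<open>b\<close> are collinear in this order, up to a
  bounded error. Applying \<open>\<phi>\<inverse>\<close> moves \<open>a\<close> to the short word \<open>u\<close>, which then lies almost between the
  two long words \<open>w = \<phi>\<inverse> u\<close> and \<open>z = \<phi>\<inverse> b\<close>; hence \<open>d w z\<close> is about \<open>\<gamma> (|w| + |z|)\<close>.
  This is impossible: replacing letters instead of deleting and inserting them shows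
  \<open>d w z \<le> \<gamma> (|w| + |z|) - (2 \<gamma> - \<theta>) min |w| |z|\<close>.

  Given finite orbits, number the words of \<open>L\<close>; an isometry permutes the numbers of the words in
  an orbit with largest number \<open>n\<close>, which gives an element of \<open>S\<^sub>n\<close>.\<close>

section \<open>Higman's lemma over a finite alphabet\<close>

text \<open>Nash-Williams' minimal bad sequence argument: in a bad sequence chosen with successively
  shortest words, infinitely many words share their first letter; cutting it off yields a bad
  sequence that is too short.\<close>

lemma higman_finite:
  fixes s :: "nat \<Rightarrow> 'a list"
  assumes "finite A" and "\<And>i. s i \<in> lists A"
  shows "\<exists>i j. i < j \<and> subseq (s i) (s j)"
proof (rule ccontr)
  define bad :: "(nat \<Rightarrow> 'a list) \<Rightarrow> bool" where
    "bad g \<longleftrightarrow> (\<forall>i. g i \<in> lists A) \<and> (\<forall>i j. i < j \<longrightarrow> \<not> subseq (g i) (g j))" for g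
  define least_at where "least_at n f \<longleftrightarrow>
    bad f \<and> (\<forall>g. bad g \<and> (\<forall>i<n. g i = f i) \<longrightarrow> length (f n) \<le> length (g n))" for n f
  assume "\<not> ?thesis"
  then have "bad s" using assms(2) by (auto simp: bad_def)
  have step: "\<exists>f'. least_at n f' \<and> (\<forall>i<n. f' i = f i)" if "bad f" for f n
  proof -
    define Q where "Q g \<longleftrightarrow> bad g \<and> (\<forall>i<n. g i = f i)" for g
    have "Q f" using that by (simp add: Q_def)
    from ex_has_least_nat[of Q f "\<lambda>g. length (g n)", OF this]
    obtain f' where f': "Q f'" "\<And>g. Q g \<Longrightarrow> length (f' n) \<le> length (g n)" by blast
    then have "least_at n f'" by (auto simp: least_at_def Q_def)
    then show ?thesis using f'(1) by (auto simp: Q_def)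
  qed
  have "\<exists>F. \<forall>n. least_at n (F n) \<and> (\<forall>i<Suc n. F (Suc n) i = F n i)"
  proof (rule dependent_nat_choice)
    show "\<exists>f. least_at 0 f" using step[OF \<open>bad s\<close>] by blast
    show "\<exists>f'. least_at (Suc n) f' \<and> (\<forall>i<Suc n. f' i = f i)" if "least_at n f" for f n
      using step that unfolding least_at_def by blast
  qed
  then obtain F where F: "\<And>n. least_at n (F n)"
    and F_Suc: "\<And>n i. i < Suc n \<Longrightarrow> F (Suc n) i = F n i" by blast
  \<comment> \<open>The diagonal agrees with \<open>F n\<close> up to index \<open>n\<close>, so it
    inherits badness and, at each index, the minimality of \<open>F n\<close>.\<close>
  define m where "m i = F i i" for i
  have F_m: "F j i = m i" if "i \<le> j" for i j
    using that by (induction rule: dec_induct) (auto simp: m_def F_Suc)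
  have bad_F: "bad (F n)" for n using F by (simp add: least_at_def)
  have m_lists: "m i \<in> lists A" for i using bad_F[of i] unfolding bad_def m_def by blast
  have m_bad: "\<not> subseq (m i) (m j)" if "i < j" for i j
  proof -
    have "\<not> subseq (F j i) (F j j)" using bad_F[of j] that unfolding bad_def by blast
    then show ?thesis using F_m[of i j] that by (simp add: m_def)
  qed
  have m_least: "length (m n) \<le> length (g n)" if "bad g" "\<And>i. i < n \<Longrightarrow> g i = m i" for g n
    using F[of n] that F_m[of _ n] unfolding least_at_def m_def by (metis less_imp_le)
  have m_ne: "m i \<noteq> []" for i
  proof
    assume "m i = []"
    then show False using m_bad[of i "Suc i"] by simp
  qed
  have "hd (m i) \<in> A" for i using m_lists[of i] m_ne[of i] by (cases "m i") auto
  then have "finite (range (\<lambda>i. hd (m i)))"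
    using assms(1) by (auto intro: finite_subset)
  from pigeonhole_infinite[OF infinite_UNIV_nat this]
  obtain k where inf: "infinite {i. hd (m i) = hd (m k)}" by auto
  define I where "I = {i. hd (m i) = hd (m k)}"
  define e where "e = enumerate I"
  have e: "strict_mono e" using inf by (simp add: e_def I_def strict_mono_enumerate)
  have e_I: "e i \<in> I" for i
    unfolding e_def using inf by (intro enumerate_in_set) (simp add: I_def)
  have m_e: "m (e i) = hd (m k) # tl (m (e i))" for i
    using m_ne[of "e i"] e_I[of i] by (cases "m (e i)") (auto simp: I_def)
  \<comment> \<open>Before the first index \<open>e 0\<close> of a word with the common letter
    nothing changes; from there on only the tails of such words are kept. An embedding between two
    tails would extend to one between the full words.\<close>
  define g where "g i = (if i < e 0 then m i else tl (m (e (i - e 0))))" for i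
  have "bad g" unfolding bad_def
  proof (intro conjI allI impI)
    show "g i \<in> lists A" for i
      using m_lists by (auto simp: g_def dest: list.set_sel(2)[OF m_ne])
    show "\<not> subseq (g i) (g j)" if "i < j" for i j
    proof (cases "j < e 0")
      case True
      then show ?thesis using that m_bad by (simp add: g_def)
    next
      case j: False
      let ?j = "e (j - e 0)"
      show ?thesis
      proof (cases "i < e 0")
        case True
        also have "e 0 \<le> ?j" using e by (simp add: strict_mono_less_eq)
        finally have "\<not> subseq (m i) (m ?j)" by (rule m_bad)
        then have "\<not> subseq (m i) (tl (m ?j))" by (metis m_e list_emb_Cons)
        then show ?thesis using True j by (simp add: g_def)
      next
        case False
        then have "e (i - e 0) < ?j" using that e by (simp add: strict_mono_less)
        then have "\<not> subseq (m (e (i - e 0))) (m ?j)" by (rule m_bad)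
        then have "\<not> subseq (tl (m (e (i - e 0)))) (tl (m ?j))" by (metis m_e subseq_Cons2)
        then show ?thesis using False j by (simp add: g_def)
      qed
    qed
  qed
  then have "length (m (e 0)) \<le> length (g (e 0))"
    by (rule m_least) (simp add: g_def)
  then show False using m_ne[of "e 0"] by (cases "m (e 0)") (auto simp: g_def)
qed

section \<open>Bounds on the distance in terms of word lengths\<close>

lemma edits_length:
  "edits A n m u v \<Longrightarrow> length u \<le> length v + n \<and> length v \<le> length u + n"
  by (induction rule: edits.induct) auto

text \<open>The prefix \<open>p\<close> collects the letters already treated, so that the induction
  can run through \<open>x\<close> from left to right.\<close>

lemma edits_replace_suffix:
  "edits A n m u (p @ x) \<Longrightarrow> length x = length y \<Longrightarrow> y \<in> lists A \<Longrightarrow> edits A n (m + length x) u (p @ y)"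
proof (induction x arbitrary: p y m)
  case (Cons c x)
  then obtain b y' where y: "y = b # y'" by (cases y) auto
  have "edits A n (Suc m) u (p @ b # x)"
    using edits.repl[OF Cons.prems(1)] Cons.prems(3) by (simp add: y)
  then have "edits A n (Suc m + length x) u ((p @ [b]) @ y')"
    using Cons.prems by (intro Cons.IH) (auto simp: y)
  then show ?case by (simp add: y)
qed simp

lemma edits_delete_suffix:
  "edits A n m u (p @ x) \<Longrightarrow> edits A (n + length x) m u p"
proof (induction x arbitrary: n)
  case (Cons c x)
  from Cons.IH[OF edits.del[OF Cons.prems]] show ?case by simp
qed simp

text \<open>Either \<open>x\<close> embeds in the tail of the target, whose head is then inserted
  last, or the heads agree and the common letter moves into \<open>p\<close>.\<close>

lemma edits_insert_subseq:
  "edits A n m u (p @ x) \<Longrightarrow> subseq x y \<Longrightarrow> y \<in> lists A \<Longrightarrow>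
    edits A (n + (length y - length x)) m u (p @ y)"
proof (induction y arbitrary: p x)
  case (Cons b y)
  show ?case
  proof (cases "subseq x y")
    case True
    then have "edits A (n + (length y - length x)) m u (p @ y)"
      using Cons by auto
    from edits.ins[OF this, of b] show ?thesis
      using Cons.prems(3) list_emb_length[OF True] by (simp add: Suc_diff_le)
  next
    case False
    then obtain x' where x': "x = b # x'" "subseq x' y"
      using Cons.prems(2) by (auto elim: list_emb.cases)
    have "edits A (n + (length y - length x')) m u ((p @ [b]) @ y)"
      using Cons.prems x' by (intro Cons.IH) auto
    then show ?thesis by (simp add: x')
  qed
qed (auto dest: list_emb_Nil2)

text \<open>Replacements keep the length, and an insertion or deletion changes it by one.\<close>

lemma lev_ge_length_diff:
  assumes "\<gamma> > 0" "\<theta> > 0" "u \<in> lists A" "v \<in> lists A"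
  shows "\<gamma> * \<bar>real (length u) - real (length v)\<bar> \<le> lev A \<gamma> \<theta> u v"
proof -
  obtain n m where nm: "edits A n m u v" "lev A \<gamma> \<theta> u v = \<gamma> * real n + \<theta> * real m"
    using lev_attained(1)[OF assms] by blast
  have "\<bar>real (length u) - real (length v)\<bar> \<le> real n"
    using edits_length[OF nm(1)] by linarith
  then have "\<gamma> * \<bar>real (length u) - real (length v)\<bar> \<le> \<gamma> * real n"
    using assms(1) by simp
  moreover have "0 \<le> \<theta> * real m" using assms(2) by simp
  ultimately show ?thesis using nm(2) by linarith
qed

text \<open>Insertions alone suffice; with \<open>lev_ge_length_diff\<close> the bound is an
  equality.\<close>

lemma lev_subseq_le:
  assumes "\<gamma> > 0" "\<theta> > 0" "u \<in> lists A" "v \<in> lists A" "subseq u v"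
  shows "lev A \<gamma> \<theta> u v \<le> \<gamma> * (real (length v) - real (length u))"
proof -
  have "edits A (0 + (length v - length u)) 0 u ([] @ v)"
    using assms by (intro edits_insert_subseq) (auto intro: edits.refl)
  then have "edits A (length v - length u) 0 u v" by simp
  from lev_attained(2)[OF assms(1-4) this] show ?thesis
    using list_emb_length[OF assms(5)] by (simp add: of_nat_diff)
qed

text \<open>Replacing letters along the shorter length and inserting or deleting the excess costs
  \<theta> min + \<gamma> (max - min), which is the stated bound.\<close>

lemma lev_le:
  assumes "\<gamma> > 0" "\<theta> > 0" "u \<in> lists A" "v \<in> lists A"
  shows "lev A \<gamma> \<theta> u v \<le> \<gamma> * (real (length u) + real (length v))
    - (2 * \<gamma> - \<theta>) * min (real (length u)) (real (length v))"
proof (cases "length u \<le> length v")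
  case True
  define v1 where "v1 = take (length u) v"
  have "edits A 0 (0 + length u) u ([] @ v1)"
    using True assms(3,4)
    by (intro edits_replace_suffix) (auto intro: edits.refl simp: v1_def dest: in_set_takeD)
  then have "edits A (0 + (length v - length v1)) (length u) u ([] @ v)"
    using assms(4) by (intro edits_insert_subseq) (auto simp: v1_def prefix_imp_subseq take_is_prefix)
  then have "edits A (length v - length v1) (length u) u v" by simp
  from lev_attained(2)[OF assms this] show ?thesis
    using True by (simp add: v1_def of_nat_diff algebra_simps)
next
  case False
  define u1 where "u1 = take (length v) u"
  define u2 where "u2 = drop (length v) u"
  have "edits A 0 0 u (u1 @ u2)" using assms(3) by (auto intro: edits.refl simp: u1_def u2_def)
  from edits_delete_suffix[OF this] have "edits A (length u2) 0 u ([] @ u1)" by simp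
  from edits_replace_suffix[OF this, of v]
  have "edits A (length u2) (length u1) u v"
    using False assms(4) by (simp add: u1_def)
  from lev_attained(2)[OF assms this] show ?thesis
    using False by (simp add: u1_def u2_def of_nat_diff algebra_simps)
qed

section \<open>Finiteness of the orbits\<close>

lemma finite_isometry_orbit:
  assumes "finite A" and L: "L \<subseteq> lists A"
    and \<gamma>: "\<gamma> > 0" and \<theta>: "\<theta> > 0" and "\<theta> < 2 * \<gamma>" and u: "u \<in> L"
  shows "finite ((\<lambda>\<phi>. \<phi> u) ` carrier (isom_group (lev A \<gamma> \<theta>) L))" (is "finite ?O")
proof (rule ccontr)
  let ?d = "lev A \<gamma> \<theta>"
  let ?l = "\<lambda>x :: 'a list. real (length x)"
  assume inf: "infinite ?O"
  have O_L: "?O \<subseteq> L" using u by (auto simp: isom_group_def Bij_def dest: bij_betwE)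
  have long: "\<exists>x\<in>?O. N \<le> length x" for N
  proof (rule ccontr)
    assume "\<not> ?thesis"
    then have "?O \<subseteq> {xs. set xs \<subseteq> A \<and> length xs \<le> N}" using O_L L by fastforce
    then show False using inf finite_lists_length_le[OF assms(1)] finite_subset by blast
  qed
  \<comment> \<open>At the end \<open>K - 2 |u|\<close> bounds the shorter of \<open>w\<close> and
    \<open>z\<close> from below, and the quotient bounds it from above; \<open>K\<close> is chosen
    to make this contradictory.\<close>
  obtain K :: nat where K: "real K > 4 * \<gamma> * ?l u / (2 * \<gamma> - \<theta>) + 2 * ?l u"
    using reals_Archimedean2 by blast
  \<comment> \<open>The minimal length \<open>K\<close> will make \<open>w\<close> long, and the
    jumps by \<open>K\<close> will make \<open>z\<close> long.\<close>
  have "\<exists>s. \<forall>n. (s n \<in> ?O \<and> K \<le> length (s n)) \<and> length (s n) + K \<le> length (s (Suc n))"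
  proof (rule dependent_nat_choice)
    show "\<exists>x. x \<in> ?O \<and> K \<le> length x" using long by blast
    show "\<exists>y. (y \<in> ?O \<and> K \<le> length y) \<and> length x + K \<le> length y" for x
      using long[of "length x + K"] by (meson add_leD2)
  qed
  then obtain s where s_O: "\<And>n. s n \<in> ?O" and s_K: "\<And>n. K \<le> length (s n)"
    and s_Suc: "\<And>n. length (s n) + K \<le> length (s (Suc n))" by blast
  have s_less: "length (s i) + K \<le> length (s j)" if "i < j" for i j
    using Suc_leI[OF that]
  proof (induction rule: dec_induct)
    case base
    show ?case by (rule s_Suc)
  next
    case (step j)
    then show ?case using s_Suc[of j] by linarith
  qed
  have "s i \<in> lists A" for i using s_O O_L L by blast
  from higman_finite[OF assms(1) this]
  obtain i j where "i < j" and sub: "subseq (s i) (s j)" by blast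
  define a where "a = s i"
  define b where "b = s j"
  have ab: "K \<le> length a" "length a + K \<le> length b"
    using s_K s_less[OF \<open>i < j\<close>] by (simp_all add: a_def b_def)
  have aL: "a \<in> L" and bL: "b \<in> L" using s_O O_L by (auto simp: a_def b_def)
  obtain \<phi> where "\<phi> \<in> carrier (isom_group ?d L)" and a: "a = \<phi> u"
    using s_O[of i] by (auto simp: a_def)
  then have bij: "bij_betw \<phi> L L" and iso: "\<And>x y. x \<in> L \<Longrightarrow> y \<in> L \<Longrightarrow> ?d (\<phi> x) (\<phi> y) = ?d x y"
    by (auto simp: isom_group_def Bij_def)
  obtain w z where w: "w \<in> L" "\<phi> w = u" and z: "z \<in> L" "\<phi> z = b"
    using bij u bL by (metis bij_betw_imp_surj_on imageE)
  \<comment> \<open>\<phi> carries \<open>w\<close>, \<open>u\<close>, \<open>z\<close> to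
    \<open>u\<close>, \<open>a\<close>, \<open>b\<close>.\<close>
  have eq: "?d w u = ?d u a" "?d u z = ?d a b" "?d w z = ?d u b"
    using iso[of w u] iso[of u z] iso[of w z] w z u a by auto
  note in_lists = u[THEN subsetD[OF L]] aL[THEN subsetD[OF L]] bL[THEN subsetD[OF L]]
    w(1)[THEN subsetD[OF L]] z(1)[THEN subsetD[OF L]]
  have ge: "\<gamma> * (?l x - ?l y) \<le> ?d x y" "\<gamma> * (?l y - ?l x) \<le> ?d x y"
    if "x \<in> lists A" "y \<in> lists A" for x y
  proof -
    have "\<gamma> * (?l x - ?l y) \<le> \<gamma> * \<bar>?l x - ?l y\<bar>" "\<gamma> * (?l y - ?l x) \<le> \<gamma> * \<bar>?l x - ?l y\<bar>"
      using \<gamma> by (auto intro: mult_left_mono)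
    then show "\<gamma> * (?l x - ?l y) \<le> ?d x y" "\<gamma> * (?l y - ?l x) \<le> ?d x y"
      using lev_ge_length_diff[OF \<gamma> \<theta> that] by linarith+
  qed
  have le: "?d x y \<le> \<gamma> * (?l x + ?l y)" if "x \<in> lists A" "y \<in> lists A" for x y
  proof -
    have "0 \<le> (2 * \<gamma> - \<theta>) * min (?l x) (?l y)" using assms(5) by simp
    then show ?thesis using lev_le[OF \<gamma> \<theta> that] by linarith
  qed
  \<comment> \<open>The first two equations of \<open>eq\<close> and the length bounds determine
    \<open>|w|\<close> as \<open>|a|\<close> and \<open>|z|\<close> as \<open>|b| - |a|\<close>, up
    to multiples of \<open>|u|\<close>.\<close>
  have "\<gamma> * (?l a - ?l u) \<le> \<gamma> * (?l w + ?l u)"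
    using ge(2)[of u a] le[of w u] eq(1) in_lists by linarith
  then have w_ge: "?l a - 2 * ?l u \<le> ?l w" using \<gamma> by simp
  have "\<gamma> * (?l w - ?l u) \<le> \<gamma> * (?l u + ?l a)"
    using ge(1)[of w u] le[of u a] eq(1) in_lists by linarith
  then have w_le: "?l w \<le> ?l a + 2 * ?l u" using \<gamma> by simp
  have "\<gamma> * (?l b - ?l a) \<le> \<gamma> * (?l u + ?l z)"
    using ge(2)[of a b] le[of u z] eq(2) in_lists by linarith
  then have z_ge: "?l b - ?l a - ?l u \<le> ?l z" using \<gamma> by simp
  \<comment> \<open>Here the subword relation enters: without it, \<open>z\<close> could be longer
    than \<open>|b| - |a|\<close> by an amount not controlled by \<open>|u|\<close>.\<close>
  have "\<gamma> * (?l z - ?l u) \<le> \<gamma> * (?l b - ?l a)"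
    using ge(2)[of u z] lev_subseq_le[OF \<gamma> \<theta> in_lists(2,3)] eq(2) in_lists sub
    by (fastforce simp: a_def b_def)
  then have z_le: "?l z \<le> ?l b - ?l a + ?l u" using \<gamma> by simp
  \<comment> \<open>The third equation of \<open>eq\<close>: the distance of \<open>w\<close> and
    \<open>z\<close> equals that of \<open>u\<close> and \<open>b\<close>, which is too large for
    the saving by replacements.\<close>
  have "(2 * \<gamma> - \<theta>) * min (?l w) (?l z) \<le> \<gamma> * (?l w + ?l z) - \<gamma> * (?l b - ?l u)"
    using lev_le[OF \<gamma> \<theta> in_lists(4,5)] ge(2)[OF in_lists(1,3)] eq(3) by linarith
  also have "\<dots> = \<gamma> * (?l w + ?l z - ?l b + ?l u)" by (simp add: algebra_simps)
  also have "\<dots> \<le> \<gamma> * (4 * ?l u)" using \<gamma> w_le z_le by (intro mult_left_mono) auto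
  finally have "min (?l w) (?l z) \<le> 4 * \<gamma> * ?l u / (2 * \<gamma> - \<theta>)"
    using assms(5) by (simp add: field_simps)
  moreover have "real K - 2 * ?l u \<le> min (?l w) (?l z)"
    using w_ge z_ge ab by simp
  ultimately show False using K by linarith
qed

section \<open>From finite orbits to the embedding\<close>

text \<open>The sets \<open>fiber n\<close> are invariant, cover \<open>L\<close>, and have their
  numbers in \<open>{1..n}\<close>; the actions on all of them together are faithful.\<close>

lemma isom_group_embeds_if_finite_orbits:
  assumes "countable L"
    and fin: "\<And>u. u \<in> L \<Longrightarrow> finite ((\<lambda>\<phi>. \<phi> u) ` carrier (isom_group d L))"
  shows "\<exists>h. h \<in> mon (isom_group d L) (product_group {(1::nat)..} sym_group)"
proof -
  let ?G = "isom_group d L"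
  interpret G: group ?G by (rule group_isom_group)
  \<comment> \<open>Numbering starts at 1 because \<open>sym_group n\<close> acts on
    \<open>{1..n}\<close>.\<close>
  define c where "c u = Suc (to_nat_on L u)" for u
  have inj_c: "inj_on c L"
    using assms(1) by (auto simp: inj_on_def c_def)
  have bij: "bij_betw \<phi> L L" if "\<phi> \<in> carrier ?G" for \<phi>
    using that by (simp add: isom_group_def Bij_def)
  have in_L: "\<phi> u \<in> L" if "\<phi> \<in> carrier ?G" "u \<in> L" for \<phi> u
    using bij[OF that(1)] that(2) by (auto dest: bij_betwE)
  have mult: "(\<phi> \<otimes>\<^bsub>?G\<^esub> \<psi>) u = \<phi> (\<psi> u)"
    if "\<phi> \<in> carrier ?G" "\<psi> \<in> carrier ?G" "u \<in> L" for \<phi> \<psi> u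
    using that by (simp add: isom_group_def BijGroup_def compose_eq)
  have one: "\<one>\<^bsub>?G\<^esub> u = u" if "u \<in> L" for u
    using that by (simp add: isom_group_def BijGroup_def)
  define top where "top u = Max (c ` (\<lambda>\<phi>. \<phi> u) ` carrier ?G)" for u
  have c_le_top: "c u \<le> top u" if "u \<in> L" for u
  proof -
    have "u \<in> (\<lambda>\<phi>. \<phi> u) ` carrier ?G" by (rule image_eqI[OF _ G.one_closed]) (simp add: one that)
    then show ?thesis unfolding top_def using fin[OF that] by (intro Max_ge) auto
  qed
  have top_eq: "top (\<phi> u) = top u" if \<phi>: "\<phi> \<in> carrier ?G" and u: "u \<in> L" for \<phi> u
  proof -
    have "(\<lambda>\<psi>. \<psi> (\<phi> u)) ` carrier ?G = (\<lambda>\<psi>. \<psi> u) ` carrier ?G"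
    proof (intro equalityI image_subsetI)
      fix \<psi> assume \<psi>: "\<psi> \<in> carrier ?G"
      show "\<psi> (\<phi> u) \<in> (\<lambda>\<psi>. \<psi> u) ` carrier ?G"
        by (rule image_eqI[OF _ G.m_closed[OF \<psi> \<phi>]]) (simp add: mult \<phi> \<psi> u)
      \<comment> \<open>\<psi> after the inverse of \<phi> takes \<phi> \<open>u\<close> to \<psi>
        \<open>u\<close>.\<close>
      have "\<psi> \<otimes>\<^bsub>?G\<^esub> inv\<^bsub>?G\<^esub> \<phi> \<otimes>\<^bsub>?G\<^esub> \<phi> = \<psi>" using \<phi> \<psi> by (simp add: G.m_assoc)
      then show "\<psi> u \<in> (\<lambda>\<psi>. \<psi> (\<phi> u)) ` carrier ?G"
        using \<phi> \<psi> u mult[of "\<psi> \<otimes>\<^bsub>?G\<^esub> inv\<^bsub>?G\<^esub> \<phi>" \<phi> u]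
        by (intro image_eqI[of _ _ "\<psi> \<otimes>\<^bsub>?G\<^esub> inv\<^bsub>?G\<^esub> \<phi>"]) auto
    qed
    then show ?thesis by (simp add: top_def)
  qed
  define fiber where "fiber n = {u \<in> L. top u = n}" for n
  \<comment> \<open>The action on \<open>fiber n\<close>, transported to numbers; the identity
    elsewhere makes it a permutation of all of \<open>{1..n}\<close>.\<close>
  define p where "p n \<phi> k = (if k \<in> c ` fiber n then c (\<phi> (inv_into L c k)) else k)" for n \<phi> k
  have p_c: "p n \<phi> (c u) = c (\<phi> u)" if "u \<in> fiber n" for n \<phi> u
    using that inj_c by (simp add: p_def fiber_def)
  have fiber_bij: "bij_betw \<phi> (fiber n) (fiber n)" if \<phi>: "\<phi> \<in> carrier ?G" for \<phi> n
  proof (rule bij_betwI')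
    show "\<phi> x = \<phi> y \<longleftrightarrow> x = y" if "x \<in> fiber n" "y \<in> fiber n" for x y
      using that bij_betw_imp_inj_on[OF bij[OF \<phi>]] by (intro inj_on_eq_iff) (auto simp: fiber_def)
    show "\<phi> x \<in> fiber n" if "x \<in> fiber n" for x
      using that in_L \<phi> top_eq by (auto simp: fiber_def)
    show "\<exists>x\<in>fiber n. y = \<phi> x" if y: "y \<in> fiber n" for y
    proof -
      obtain x where "x \<in> L" "y = \<phi> x"
        using y bij_betw_imp_surj_on[OF bij[OF \<phi>]] unfolding fiber_def by blast
      then show ?thesis using y top_eq[OF \<phi>] by (auto simp: fiber_def)
    qed
  qed
  have p_permutes: "p n \<phi> permutes {1..n}" if \<phi>: "\<phi> \<in> carrier ?G" for n \<phi>
  proof -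
    have inj_f: "inj_on c (fiber n)" using inj_c by (rule inj_on_subset) (auto simp: fiber_def)
    have "bij_betw (p n \<phi>) (c ` fiber n) (c ` fiber n)"
    proof (rule bij_betw_imageI)
      have "inj_on (c \<circ> \<phi>) (fiber n)"
        using fiber_bij[OF \<phi>, of n] inj_f by (auto simp: bij_betw_def intro: comp_inj_on)
      then have "inj_on (p n \<phi> \<circ> c) (fiber n)"
        by (rule inj_on_cong[THEN iffD1, rotated]) (simp add: p_c)
      then show "inj_on (p n \<phi>) (c ` fiber n)" by (rule inj_on_imageI)
      have "p n \<phi> ` c ` fiber n = c ` \<phi> ` fiber n"
        unfolding image_image by (rule image_cong) (simp_all add: p_c)
      then show "p n \<phi> ` c ` fiber n = c ` fiber n"
        using fiber_bij[OF \<phi>, of n] by (simp add: bij_betw_def)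
    qed
    then have "p n \<phi> permutes c ` fiber n"
      by (rule bij_imp_permutes) (simp add: p_def)
    moreover have "c ` fiber n \<subseteq> {1..n}"
      using c_le_top by (auto simp: fiber_def c_def)
    ultimately show ?thesis by (rule permutes_subset)
  qed
  \<comment> \<open>Elements of the product group are extensional on the index set, hence the
    restriction.\<close>
  define h where "h \<phi> = (\<lambda>n\<in>{(1::nat)..}. p n \<phi>)" for \<phi>
  have "h \<in> hom ?G (product_group {1..} sym_group)"
  proof (rule homI)
    show "h \<phi> \<in> carrier (product_group {1..} sym_group)" if "\<phi> \<in> carrier ?G" for \<phi>
      using p_permutes[OF that] by (auto simp: h_def sym_group_def)
    fix \<phi> \<psi> assume \<phi>: "\<phi> \<in> carrier ?G" and \<psi>: "\<psi> \<in> carrier ?G"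
    have "p n (\<phi> \<otimes>\<^bsub>?G\<^esub> \<psi>) k = p n \<phi> (p n \<psi> k)" for n k
    proof (cases "k \<in> c ` fiber n")
      case True
      then obtain u where u: "u \<in> fiber n" "k = c u" by blast
      then have "\<psi> u \<in> fiber n" "u \<in> L" using fiber_bij[OF \<psi>] by (auto simp: fiber_def dest: bij_betwE)
      then show ?thesis using u by (simp add: p_c mult \<phi> \<psi>)
    qed (simp add: p_def)
    then show "h (\<phi> \<otimes>\<^bsub>?G\<^esub> \<psi>) = h \<phi> \<otimes>\<^bsub>product_group {1..} sym_group\<^esub> h \<psi>"
      by (auto simp: h_def sym_group_def fun_eq_iff)
  qed
  moreover have "inj_on h (carrier ?G)"
  proof (rule inj_onI)
    fix \<phi> \<psi> assume \<phi>: "\<phi> \<in> carrier ?G" and \<psi>: "\<psi> \<in> carrier ?G" and eq: "h \<phi> = h \<psi>"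
    have "\<phi> \<in> extensional L" "\<psi> \<in> extensional L"
      using \<phi> \<psi> by (simp_all add: isom_group_def Bij_def)
    then show "\<phi> = \<psi>"
    proof (rule extensionalityI)
      fix u assume u: "u \<in> L"
      \<comment> \<open>The coordinate \<open>top u\<close> recovers the image of \<open>u\<close>;
        it must lie in the index set, which starts at 1.\<close>
      then have "1 \<le> top u" using c_le_top[OF u] by (simp add: c_def)
      then have "p (top u) \<phi> = p (top u) \<psi>" using fun_cong[OF eq, of "top u"] by (simp add: h_def)
      then have "c (\<phi> u) = c (\<psi> u)" using p_c[of u "top u"] u by (metis (mono_tags) fiber_def mem_Collect_eq)
      then show "\<phi> u = \<psi> u" using inj_c in_L \<phi> \<psi> u by (auto dest: inj_onD)
    qed
  qed
  ultimately show ?thesis by (auto simp: mon_def)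
qed

theorem corollary1:
  fixes A :: "'a set" and L :: "'a list set" and \<gamma> \<theta> :: real
  assumes "finite A" and "L \<subseteq> lists A"
    and "\<gamma> > 0" and "\<theta> > 0" and "\<theta> < 2 * \<gamma>"
  shows "\<exists>h. h \<in> mon (isom_group (lev A \<gamma> \<theta>) L) (product_group {(1::nat)..} sym_group)"
proof (rule isom_group_embeds_if_finite_orbits)
  have "countable (lists A)" using assms(1) by (intro countable_lists countable_finite)
  then show "countable L" using assms(2) by (rule countable_subset[rotated])
qed (rule finite_isometry_orbit[OF assms])

end
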